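(* Let $a,b,c\in\mathbb R$ and let $V$ be the vector field on the flat torus $T^3=(\mathbb R/2\pi\mathbb Z)^3$ with coordinates $(x,y,z)$ and flat metric $g_0=dx^2+dy^2+dz^2$ given by $$V=\big(a\sin z+c\cos y,\ b\sin x+a\cos z,\ c\sin y+b\cos x\big).$$ Let $U=\{p\in T^3:V(p)\ne0\}$ and let $\beta=\iota_V(dx\wedge dy\wedge dz)$ be the corresponding $2$-form on $U$. Then $\beta$ is conformally geodesic on $U$, i.e. there is a Riemannian metric $h=e^{2u}g_0$ on $U$ with $u\in C^\infty(U)$ such that $\beta$ is geodesic with respect to $h$.
   Context: For a Riemannian metric $h$ on an oriented $3$-manifold with volume form $\mu_h$ and Levi-Civita connection $\nabla$, the vector field $B$ associated to a closed $2$-form $\beta$ is defined by $\iota_B\mu_h=\beta$, and $\beta$ is geodesic with respect to $h$ if $\nabla_BB=\rho B$ for some smooth function $\rho$. The vector fields $V$ are the Arnold–Beltrami–Childress (ABC) flows. *)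

theory Defs
  imports "HOL-Analysis.Analysis"
begin

subsection \<open>The torus\<close>

quotient_type circle = real / "\<lambda>s t. \<exists>k::int. s - t = 2 * pi * of_int k"
proof (rule equivpI)
  show "reflp (\<lambda>s t::real. \<exists>k::int. s - t = 2 * pi * of_int k)"
    by (auto intro!: reflpI exI[of _ 0])
  show "symp (\<lambda>s t::real. \<exists>k::int. s - t = 2 * pi * of_int k)"
    by (rule sympI) (metis minus_diff_eq mult_minus_right of_int_minus)
  show "transp (\<lambda>s t::real. \<exists>k::int. s - t = 2 * pi * of_int k)"
  proof (rule transpI)
    fix r s t :: real
    assume "\<exists>k::int. r - s = 2 * pi * of_int k" "\<exists>k::int. s - t = 2 * pi * of_int k"
    then obtain k l :: int where "r - s = 2 * pi * of_int k" "s - t = 2 * pi * of_int l"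
      by blast
    then have "r - t = 2 * pi * of_int (k + l)"
      by (simp add: algebra_simps)
    then show "\<exists>k::int. r - t = 2 * pi * of_int k" ..
  qed
qed

type_synonym torus = "circle ^ 3"

lift_definition csin :: "circle \<Rightarrow> real" is sin
proof -
  fix s t :: real
  assume "\<exists>k::int. s - t = 2 * pi * of_int k"
  then obtain k :: int where "s = t + 2 * pi * of_int k"
    by (auto simp: algebra_simps)
  then show "sin s = sin t"
    by (simp add: sin_add)
qed

lift_definition ccos :: "circle \<Rightarrow> real" is cos
proof -
  fix s t :: real
  assume "\<exists>k::int. s - t = 2 * pi * of_int k"
  then obtain k :: int where "s = t + 2 * pi * of_int k"
    by (auto simp: algebra_simps)
  then show "cos s = cos t"
    by (simp add: cos_add)
qed

definition torus_proj :: "real ^ 3 \<Rightarrow> torus" where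
  "torus_proj x = (\<chi> i. abs_circle (x $ i))"

definition torus_rep :: "torus \<Rightarrow> real ^ 3" where
  "torus_rep p = (\<chi> i. rep_circle (p $ i))"


subsection \<open>Calculus on the torus\<close>

text \<open>
  Tangent spaces are identified with \<open>real ^ 3\<close> through the global frame of coordinate fields.
  So a vector field is a function \<open>torus \<Rightarrow> real ^ 3\<close>, a tensor field is a function of a point and
  of tangent vectors, and functions and fields are differentiated through their
  periodic lifts along \<open>torus_proj\<close>. Everything lives on an open set \<open>U\<close> of the torus; values
  outside \<open>U\<close> are irrelevant.
\<close>

type_synonym vfield = "torus \<Rightarrow> real ^ 3"
type_synonym two_form = "torus \<Rightarrow> real ^ 3 \<Rightarrow> real ^ 3 \<Rightarrow> real"
type_synonym three_form = "torus \<Rightarrow> real ^ 3 \<Rightarrow> real ^ 3 \<Rightarrow> real ^ 3 \<Rightarrow> real"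
type_synonym metric_field = "torus \<Rightarrow> real ^ 3 \<Rightarrow> real ^ 3 \<Rightarrow> real"

text \<open>\<open>C\<^sup>k\<close> on an open set of Euclidean space.\<close>

fun Ck_on :: "nat \<Rightarrow> (real ^ 3) set \<Rightarrow> (real ^ 3 \<Rightarrow> 'b::real_normed_vector) \<Rightarrow> bool" where
  "Ck_on 0 S f \<longleftrightarrow> continuous_on S f"
| "Ck_on (Suc k) S f \<longleftrightarrow>
     (\<forall>x\<in>S. f differentiable (at x)) \<and>
     (\<forall>v. Ck_on k S (\<lambda>x. frechet_derivative f (at x) v))"

definition smooth_on :: "torus set \<Rightarrow> (torus \<Rightarrow> 'b::real_normed_vector) \<Rightarrow> bool" where
  "smooth_on U f \<longleftrightarrow> (\<forall>k. Ck_on k (torus_proj -` U) (\<lambda>x. f (torus_proj x)))"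

text \<open>
  The derivative of \<open>f\<close> at \<open>p\<close> in direction \<open>v\<close>; since the lift of \<open>f\<close> is periodic, the choice
  of the representative of \<open>p\<close> does not matter.
\<close>

definition dir_deriv :: "(torus \<Rightarrow> 'b::real_normed_vector) \<Rightarrow> torus \<Rightarrow> real ^ 3 \<Rightarrow> 'b" where
  "dir_deriv f p v = frechet_derivative (\<lambda>x. f (torus_proj x)) (at (torus_rep p)) v"

definition lie_bracket :: "vfield \<Rightarrow> vfield \<Rightarrow> vfield" where
  "lie_bracket X Y p = dir_deriv Y p (X p) - dir_deriv X p (Y p)"

definition smooth_two_form :: "torus set \<Rightarrow> two_form \<Rightarrow> bool" where
  "smooth_two_form U \<beta> \<longleftrightarrow>
     (\<forall>p\<in>U. bilinear (\<beta> p) \<and> (\<forall>v. \<beta> p v v = 0)) \<and>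
     (\<forall>v w. smooth_on U (\<lambda>p. \<beta> p v w))"

text \<open>
  The invariant formula for the exterior derivative, on coordinate-constant fields (so that
  the bracket terms vanish).
\<close>

definition ext_deriv :: "two_form \<Rightarrow> three_form" where
  "ext_deriv \<beta> p v\<^sub>1 v\<^sub>2 v\<^sub>3 =
     dir_deriv (\<lambda>q. \<beta> q v\<^sub>2 v\<^sub>3) p v\<^sub>1 - dir_deriv (\<lambda>q. \<beta> q v\<^sub>1 v\<^sub>3) p v\<^sub>2
       + dir_deriv (\<lambda>q. \<beta> q v\<^sub>1 v\<^sub>2) p v\<^sub>3"

definition closed_two_form :: "torus set \<Rightarrow> two_form \<Rightarrow> bool" where
  "closed_two_form U \<beta> \<longleftrightarrow>
     smooth_two_form U \<beta> \<and> (\<forall>p\<in>U. \<forall>v\<^sub>1 v\<^sub>2 v\<^sub>3. ext_deriv \<beta> p v\<^sub>1 v\<^sub>2 v\<^sub>3 = 0)"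

definition interior_product :: "vfield \<Rightarrow> three_form \<Rightarrow> two_form" where
  "interior_product X \<omega> p v w = \<omega> p (X p) v w"

definition dx_dy_dz :: three_form where
  "dx_dy_dz p v\<^sub>1 v\<^sub>2 v\<^sub>3 = det (vector [v\<^sub>1, v\<^sub>2, v\<^sub>3] :: real ^ 3 ^ 3)"


subsection \<open>Riemannian geometry\<close>

definition riemannian_metric :: "torus set \<Rightarrow> metric_field \<Rightarrow> bool" where
  "riemannian_metric U h \<longleftrightarrow>
     (\<forall>p\<in>U. bilinear (h p) \<and> (\<forall>v w. h p v w = h p w v) \<and> (\<forall>v. v \<noteq> 0 \<longrightarrow> h p v v > 0)) \<and>
     (\<forall>v w. smooth_on U (\<lambda>p. h p v w))"

definition flat_metric :: metric_field where
  "flat_metric p v w = v \<bullet> w"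

text \<open>The Riemannian volume form for the orientation \<open>dx \<and> dy \<and> dz\<close>.\<close>

definition volume_form :: "metric_field \<Rightarrow> three_form" where
  "volume_form h p v\<^sub>1 v\<^sub>2 v\<^sub>3 =
     sqrt (det (\<chi> i j. h p (axis i 1) (axis j 1))) * dx_dy_dz p v\<^sub>1 v\<^sub>2 v\<^sub>3"

definition affine_connection :: "torus set \<Rightarrow> (vfield \<Rightarrow> vfield \<Rightarrow> vfield) \<Rightarrow> bool" where
  "affine_connection U D \<longleftrightarrow>
     (\<forall>X Y. smooth_on U X \<longrightarrow> smooth_on U Y \<longrightarrow> smooth_on U (D X Y)) \<and>
     (\<forall>X X' Y Y'. smooth_on U X \<longrightarrow> smooth_on U Y \<longrightarrow>
        (\<forall>p\<in>U. X p = X' p \<and> Y p = Y' p) \<longrightarrow> (\<forall>p\<in>U. D X Y p = D X' Y' p)) \<and>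
     (\<forall>X X' Y. smooth_on U X \<longrightarrow> smooth_on U X' \<longrightarrow> smooth_on U Y \<longrightarrow>
        (\<forall>p\<in>U. D (\<lambda>q. X q + X' q) Y p = D X Y p + D X' Y p)) \<and>
     (\<forall>f X Y. smooth_on U f \<longrightarrow> smooth_on U X \<longrightarrow> smooth_on U Y \<longrightarrow>
        (\<forall>p\<in>U. D (\<lambda>q. f q *\<^sub>R X q) Y p = f p *\<^sub>R D X Y p)) \<and>
     (\<forall>X Y Y'. smooth_on U X \<longrightarrow> smooth_on U Y \<longrightarrow> smooth_on U Y' \<longrightarrow>
        (\<forall>p\<in>U. D X (\<lambda>q. Y q + Y' q) p = D X Y p + D X Y' p)) \<and>
     (\<forall>f X Y. smooth_on U f \<longrightarrow> smooth_on U X \<longrightarrow> smooth_on U Y \<longrightarrow>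
        (\<forall>p\<in>U. D X (\<lambda>q. f q *\<^sub>R Y q) p = dir_deriv f p (X p) *\<^sub>R Y p + f p *\<^sub>R D X Y p))"

definition levi_civita ::
    "torus set \<Rightarrow> metric_field \<Rightarrow> (vfield \<Rightarrow> vfield \<Rightarrow> vfield) \<Rightarrow> bool" where
  "levi_civita U h D \<longleftrightarrow>
     affine_connection U D \<and>
     (\<forall>X Y. smooth_on U X \<longrightarrow> smooth_on U Y \<longrightarrow>
        (\<forall>p\<in>U. D X Y p - D Y X p = lie_bracket X Y p)) \<and>
     (\<forall>X Y Z. smooth_on U X \<longrightarrow> smooth_on U Y \<longrightarrow> smooth_on U Z \<longrightarrow>
        (\<forall>p\<in>U. dir_deriv (\<lambda>q. h q (Y q) (Z q)) p (X p) =
                 h p (D X Y p) (Z p) + h p (Y p) (D X Z p)))"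

definition associated_field :: "torus set \<Rightarrow> metric_field \<Rightarrow> two_form \<Rightarrow> vfield \<Rightarrow> bool" where
  "associated_field U h \<beta> B \<longleftrightarrow>
     smooth_on U B \<and>
     (\<forall>p\<in>U. \<forall>v w. interior_product B (volume_form h) p v w = \<beta> p v w)"

text \<open>
  On \<open>U\<close>, both the associated field and the Levi-Civita connection are unique, so the quantifiers
  over \<open>B\<close> and \<open>D\<close> merely name them.
\<close>

definition geodesic_form :: "torus set \<Rightarrow> metric_field \<Rightarrow> two_form \<Rightarrow> bool" where
  "geodesic_form U h \<beta> \<longleftrightarrow>
     riemannian_metric U h \<and> closed_two_form U \<beta> \<and>
     (\<exists>B D \<rho>. associated_field U h \<beta> B \<and> levi_civita U h D \<and> smooth_on U \<rho> \<and>
        (\<forall>p\<in>U. D B B p = \<rho> p *\<^sub>R B p))"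

definition conformally_geodesic :: "torus set \<Rightarrow> metric_field \<Rightarrow> two_form \<Rightarrow> bool" where
  "conformally_geodesic U g \<beta> \<longleftrightarrow>
     (\<exists>u. smooth_on U u \<and> geodesic_form U (\<lambda>p v w. exp (2 * u p) * g p v w) \<beta>)"

definition ABC_field :: "real \<Rightarrow> real \<Rightarrow> real \<Rightarrow> vfield" where
  "ABC_field a b c p = vector
     [a * csin (p $ 3) + c * ccos (p $ 2),
      b * csin (p $ 1) + a * ccos (p $ 3),
      c * csin (p $ 2) + b * ccos (p $ 1)]"

end

theory Submission
  imports Defs
begin

text \<open>
  The conformal factor is \<open>e\<^sup>u = |V|\<close>, i.e. \<open>h = |V|\<^sup>2 g\<^sub>0\<close>. An ABC flow is a Beltrami field,
  \<open>curl V = V\<close>, so \<open>V \<times> curl V = 0\<close> and the flat identity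
  \<open>\<nabla>\<^sub>V V = grad (|V|\<^sup>2 / 2) - V \<times> curl V\<close> says that the acceleration of \<open>V\<close> is the pure gradient
  \<open>|V|\<^sup>2 grad u\<close> with \<open>u = ln |V|\<close>. On the other hand, passing from \<open>g\<^sub>0\<close> to \<open>h = e\<^sup>2\<^sup>u g\<^sub>0\<close> changes
  \<open>\<nabla>\<^sub>V V\<close> by \<open>2 du(V) V - |V|\<^sup>2 grad u\<close>. The gradient terms cancel, which leaves a multiple of
  \<open>V\<close>. Being geodesic up to reparametrisation is unaffected by scaling the field, and the field
  of \<open>\<beta>\<close> with respect to \<open>h\<close> is \<open>B = e\<^sup>-\<^sup>3\<^sup>u V\<close>, because the volume form of \<open>h\<close> is \<open>e\<^sup>3\<^sup>u\<close> times the
  flat one; the computation yields \<open>\<nabla>\<^sub>B B = - du(B) B\<close>.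

  This argument needs of \<open>V\<close> that it is smooth and free of zeros, that \<open>V\<close> and \<open>curl V\<close> are
  parallel, and that \<open>div V = 0\<close>, which makes \<open>\<beta>\<close> closed. It is carried out in this generality
  in \<open>conformally_geodesic_of_parallel_curl\<close>, based on an explicit Levi-Civita connection for
  \<open>e\<^sup>2\<^sup>u g\<^sub>0\<close> (\<open>levi_civita_conformal\<close>). Since a connection has to map smooth fields to
  smooth fields, smoothness has to be propagated through sums, products, \<open>exp\<close>, \<open>ln\<close> and
  directional derivatives; that is the purpose of the \<open>C\<^sup>k\<close> calculus.
\<close>

section \<open>Calculus of \<open>C\<^sup>k\<close> functions on open sets\<close>

lemma frechet_derivative_cong_open:
  assumes "open S" "x \<in> S" "\<And>y. y \<in> S \<Longrightarrow> f y = g y"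
  shows "frechet_derivative f (at x) = frechet_derivative g (at x)"
proof -
  have "(f has_derivative D) (at x) \<longleftrightarrow> (g has_derivative D) (at x)" for D
    using has_derivative_transform_within_open[of f D x UNIV S g]
      has_derivative_transform_within_open[of g D x UNIV S f] assms
    by metis
  then show ?thesis
    by (simp add: frechet_derivative_def)
qed

lemma Ck_on_cong:
  assumes "open S" "\<And>x. x \<in> S \<Longrightarrow> f x = g x" "Ck_on k S f"
  shows "Ck_on k S g"
  using assms(2,3)
proof (induction k arbitrary: f g)
  case 0
  then show ?case
    using continuous_on_cong[of S S f g] by simp
next
  case (Suc k)
  have "g differentiable (at x)" if "x \<in> S" for x
    using Suc.prems that assms(1) unfolding differentiable_def
    by (metis (no_types, lifting) Ck_on.simps(2) differentiable_def has_derivative_transform_within_open)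
  moreover have "Ck_on k S (\<lambda>x. frechet_derivative g (at x) v)" for v
    using Suc.IH[of "\<lambda>x. frechet_derivative f (at x) v" "\<lambda>x. frechet_derivative g (at x) v"]
      frechet_derivative_cong_open[OF assms(1), of _ f g] Suc.prems
    by auto
  ultimately show ?case
    by simp
qed

text \<open>A derivative in closed form replaces the choice operator hidden in \<open>frechet_derivative\<close>, so
  that every closure property below becomes an induction on \<open>k\<close>.\<close>

lemma Ck_on_SucI:
  assumes "open S" "\<And>x. x \<in> S \<Longrightarrow> (f has_derivative D x) (at x)"
    and "\<And>v. Ck_on k S (\<lambda>x. D x v)"
  shows "Ck_on (Suc k) S f"
proof -
  have "Ck_on k S (\<lambda>x. frechet_derivative f (at x) v)" for v
    by (rule Ck_on_cong[OF assms(1) _ assms(3)[of v]]) (simp add: frechet_derivative_at[OF assms(2)])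
  then show ?thesis
    using assms(2) by (auto simp: differentiable_def)
qed

lemma Ck_on_SucD:
  assumes "Ck_on (Suc k) S f"
  shows "x \<in> S \<Longrightarrow> (f has_derivative frechet_derivative f (at x)) (at x)"
    and "Ck_on k S (\<lambda>x. frechet_derivative f (at x) v)"
  using assms by (auto simp: frechet_derivative_works)

lemma Ck_on_Suc_imp_Ck_on:
  assumes "Ck_on (Suc k) S f"
  shows "Ck_on k S f"
  using assms
proof (induction k arbitrary: f)
  case 0
  then show ?case
    by (auto intro!: continuous_at_imp_continuous_on differentiable_imp_continuous_within)
next
  case (Suc k)
  have "Ck_on k S (\<lambda>x. frechet_derivative f (at x) v)" for v
    by (rule Suc.IH) (rule Ck_on_SucD(2)[OF Suc.prems])
  then show ?case
    using Suc.prems by simp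
qed

lemma Ck_on_const: "open S \<Longrightarrow> Ck_on k S (\<lambda>x. c)"
proof (induction k arbitrary: c)
  case (Suc k)
  show ?case
    by (rule Ck_on_SucI[where D = "\<lambda>_ _. 0"]) (use Suc in auto)
qed simp

lemma Ck_on_add:
  assumes "open S" "Ck_on k S f" "Ck_on k S g"
  shows "Ck_on k S (\<lambda>x. f x + g x)"
  using assms(2,3)
proof (induction k arbitrary: f g)
  case 0
  then show ?case by (simp add: continuous_on_add)
next
  case (Suc k)
  show ?case
    by (rule Ck_on_SucI[OF assms(1) has_derivative_add[OF Ck_on_SucD(1)[OF Suc.prems(1)]
            Ck_on_SucD(1)[OF Suc.prems(2)]] Suc.IH[OF Ck_on_SucD(2)[OF Suc.prems(1)]
            Ck_on_SucD(2)[OF Suc.prems(2)]]])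
qed

lemma (in bounded_bilinear) Ck_on:
  assumes "open S" "Ck_on k S f" "Ck_on k S g"
  shows "Ck_on k S (\<lambda>x. prod (f x) (g x))"
  using assms(2,3)
proof (induction k arbitrary: f g)
  case 0
  then show ?case by (simp add: continuous_on)
next
  case (Suc k)
  show ?case
    by (rule Ck_on_SucI[OF assms(1) FDERIV[OF Ck_on_SucD(1)[OF Suc.prems(1)]
            Ck_on_SucD(1)[OF Suc.prems(2)]]])
      (auto intro!: Ck_on_add[OF assms(1)] Suc.IH
        Ck_on_SucD(2)[OF Suc.prems(1)] Ck_on_SucD(2)[OF Suc.prems(2)]
        Ck_on_Suc_imp_Ck_on[OF Suc.prems(1)] Ck_on_Suc_imp_Ck_on[OF Suc.prems(2)])
qed

lemma Ck_on_bounded_linear: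
  assumes "open S" "bounded_linear L" "Ck_on k S f"
  shows "Ck_on k S (\<lambda>x. L (f x))"
  using assms(3)
proof (induction k arbitrary: f)
  case 0
  then show ?case by (simp add: bounded_linear.continuous_on[OF assms(2)])
next
  case (Suc k)
  show ?case
    by (rule Ck_on_SucI[OF assms(1) bounded_linear.has_derivative[OF assms(2)
            Ck_on_SucD(1)[OF Suc.prems]] Suc.IH[OF Ck_on_SucD(2)[OF Suc.prems]]])
qed

text \<open>Presenting a smooth function of one variable by the sequence \<open>\<phi>\<close> of all its derivatives
  covers \<open>exp\<close>, \<open>ln\<close>, \<open>sin\<close> and \<open>cos\<close> at once, without a chain rule for maps between
  higher-dimensional spaces.\<close>

lemma Ck_on_compose_real:
  fixes \<phi> :: "nat \<Rightarrow> real \<Rightarrow> real"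
  assumes "open S" "Ck_on k S f" "\<And>x. x \<in> S \<Longrightarrow> f x \<in> T"
    and \<phi>: "\<And>n t. t \<in> T \<Longrightarrow> (\<phi> n has_real_derivative \<phi> (Suc n) t) (at t)"
  shows "Ck_on k S (\<lambda>x. \<phi> n (f x))"
  using assms(2)
proof (induction k arbitrary: n)
  case 0
  have "isCont (\<phi> n) t" if "t \<in> T" for t
    using \<phi>[OF that] DERIV_isCont by blast
  then have "continuous_on T (\<phi> n)"
    by (simp add: continuous_at_imp_continuous_on)
  then show ?case
    using 0 assms(3) by (auto intro!: continuous_on_compose2[of T "\<phi> n" S f])
next
  case (Suc k)
  have f: "Ck_on k S f"
    by (rule Ck_on_Suc_imp_Ck_on[OF Suc.prems])
  show ?case
  proof (rule Ck_on_SucI[OF assms(1)])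
    show "((\<lambda>x. \<phi> n (f x)) has_derivative
        (\<lambda>v. frechet_derivative f (at x) v * \<phi> (Suc n) (f x))) (at x)" if "x \<in> S" for x
      using has_derivative_compose[OF Ck_on_SucD(1)[OF Suc.prems that], of "\<phi> n"]
        \<phi>[OF assms(3)[OF that], of n]
      by (simp add: has_field_derivative_def mult.commute)
    show "Ck_on k S (\<lambda>x. frechet_derivative f (at x) v * \<phi> (Suc n) (f x))" for v
      by (rule bounded_bilinear.Ck_on[OF bounded_bilinear_mult assms(1)
            Ck_on_SucD(2)[OF Suc.prems] Suc.IH[OF f]])
  qed
qed

lemma Ck_on_exp:
  assumes "open S" "Ck_on k S f"
  shows "Ck_on k S (\<lambda>x. exp (f x :: real))"
  by (rule Ck_on_compose_real[OF assms, of UNIV "\<lambda>_. exp" for n]) (auto intro!: derivative_eq_intros)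

lemma Ck_on_ln:
  assumes "open S" "Ck_on k S f" "\<And>x. x \<in> S \<Longrightarrow> (f x :: real) > 0"
  shows "Ck_on k S (\<lambda>x. ln (f x))"
proof -
  \<comment> \<open>The derivative of order \<open>m + 1\<close> of \<open>ln\<close> is \<open>(-1)\<^sup>m m! / t\<^sup>m\<^sup>+\<^sup>1\<close>.\<close>
  define \<phi> :: "nat \<Rightarrow> real \<Rightarrow> real" where
    "\<phi> n t = (case n of 0 \<Rightarrow> ln t | Suc m \<Rightarrow> (-1) ^ m * fact m * inverse t ^ Suc m)" for n t
  have "Ck_on k S (\<lambda>x. \<phi> 0 (f x))"
  proof (rule Ck_on_compose_real[OF assms(1,2), of "{0<..}"])
    fix n and t :: real
    assume t: "t \<in> {0<..}"
    show "(\<phi> n has_real_derivative \<phi> (Suc n) t) (at t)"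
    proof (cases n)
      case 0
      then show ?thesis
        using t by (auto simp: \<phi>_def[abs_def] divide_inverse intro!: derivative_eq_intros)
    next
      case (Suc m)
      have "((\<lambda>t. inverse t ^ Suc m) has_real_derivative
          - (of_nat (Suc m) * inverse t ^ Suc (Suc m))) (at t)"
        using DERIV_power_Suc[OF DERIV_inverse, where x = t and n = m] t by (simp add: algebra_simps)
      from DERIV_cmult[OF this, of "(-1) ^ m * fact m"] Suc show ?thesis
        by (simp add: \<phi>_def[abs_def] algebra_simps)
    qed
  qed (use assms(3) in auto)
  then show ?thesis
    by (simp add: \<phi>_def)
qed

lemma Ck_on_sin:
  assumes "open S" "Ck_on k S f"
  shows "Ck_on k S (\<lambda>x. sin (f x :: real))"
proof -
  \<comment> \<open>Each differentiation shifts the phase of the sine by a quarter period.\<close>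
  have "((\<lambda>t. sin (t + real n * (pi / 2))) has_real_derivative
      sin (t + real (Suc n) * (pi / 2))) (at t)" for n t
  proof -
    have "sin (t + real (Suc n) * (pi / 2)) = sin ((t + real n * (pi / 2)) + pi / 2)"
      by (simp add: algebra_simps add_divide_distrib)
    also have "\<dots> = cos (t + real n * (pi / 2))"
      by (simp add: sin_add)
    finally show ?thesis
      by (auto intro!: derivative_eq_intros)
  qed
  from Ck_on_compose_real[OF assms, of UNIV "\<lambda>n t. sin (t + real n * (pi / 2))" 0, OF _ this]
  show ?thesis
    by simp
qed

lemma Ck_on_cos:
  assumes "open S" "Ck_on k S f"
  shows "Ck_on k S (\<lambda>x. cos (f x :: real))"
proof -
  have "Ck_on k S (\<lambda>x. sin (f x + pi / 2))"
    by (intro Ck_on_sin Ck_on_add Ck_on_const assms)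
  then show ?thesis
    by (simp add: sin_add)
qed

lemma Ck_on_vec_nth:
  assumes "open S"
  shows "Ck_on k S (\<lambda>x. x $ i)"
proof (cases k)
  case (Suc m)
  have "((\<lambda>x. x $ i) has_derivative (\<lambda>v. v $ i)) (at x)" for x :: "real ^ 3"
    by (rule bounded_linear_imp_has_derivative[OF bounded_linear_vec_nth])
  then show ?thesis
    unfolding Suc by (rule Ck_on_SucI[OF assms]) (rule Ck_on_const[OF assms])
qed (simp add: continuous_on_component)

section \<open>Smooth functions on the torus and their derivatives\<close>

lemma torus_proj_rep [simp]: "torus_proj (torus_rep p) = p"
  by (simp add: torus_proj_def torus_rep_def vec_eq_iff Quotient3_abs_rep[OF Quotient3_circle])

lemma abs_circle_shift:
  assumes "abs_circle s = abs_circle t"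
  shows "abs_circle (r + (s - t)) = abs_circle r"
  using assms by (simp add: circle.abs_eq_iff)

text \<open>The lift of a function is invariant under the translation that carries \<open>x\<close> to the chosen
  representative of its class, hence so are its derivatives. This turns \<open>dir_deriv\<close> into the
  derivative of the lift at every point of \<open>real ^ 3\<close>.\<close>

lemma dir_deriv_torus_proj:
  "dir_deriv f (torus_proj x) v = frechet_derivative (\<lambda>y. f (torus_proj y)) (at x) v"
proof -
  define w where "w = torus_rep (torus_proj x) - x"
  define F where "F y = f (torus_proj y)" for y
  have "torus_proj (torus_rep (torus_proj x)) = torus_proj x"
    by simp
  then have "abs_circle (torus_rep (torus_proj x) $ i) = abs_circle (x $ i)" for i
    by (simp add: torus_proj_def vec_eq_iff)
  then have "torus_proj (y + w) = torus_proj y" for y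
    by (simp add: torus_proj_def vec_eq_iff w_def abs_circle_shift)
  then have F: "F (y + w) = F y" for y
    by (simp add: F_def)
  have F': "F (y - w) = F y" for y
    using F[of "y - w"] by simp
  have "(F has_derivative D) (at x) \<longleftrightarrow> (F has_derivative D) (at (x + w))" for D
  proof
    assume "(F has_derivative D) (at x)"
    then show "(F has_derivative D) (at (x + w))"
      using has_derivative_compose[of "\<lambda>y. y - w" "\<lambda>v. v" "x + w" UNIV F D,
          OF has_derivative_diff[OF has_derivative_ident has_derivative_const, simplified]]
      by (simp add: F')
  next
    assume "(F has_derivative D) (at (x + w))"
    then show "(F has_derivative D) (at x)"
      using has_derivative_compose[of "\<lambda>y. y + w" "\<lambda>v. v" x UNIV F D,
          OF has_derivative_add[OF has_derivative_ident has_derivative_const, simplified]]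
      by (simp add: F)
  qed
  moreover have "x + w = torus_rep (torus_proj x)"
    by (simp add: w_def)
  ultimately have "frechet_derivative F (at (torus_rep (torus_proj x))) = frechet_derivative F (at x)"
    by (simp add: frechet_derivative_def)
  then show ?thesis
    by (simp add: dir_deriv_def F_def[abs_def])
qed

lemma dir_deriv_eqI:
  assumes "((\<lambda>x. f (torus_proj x)) has_derivative D) (at (torus_rep p))"
  shows "dir_deriv f p v = D v"
  using frechet_derivative_at[OF assms] by (simp add: dir_deriv_def)

text \<open>On an open set the derivative at a point of the set depends only on values in the set.
  In the quotient topology \<open>U\<close> is open if and only if its preimage is.\<close>

locale open_torus_subset =
  fixes U :: "torus set"
  assumes open_lift: "open (torus_proj -` U)"
begin

lemma has_dir_deriv:
  assumes "smooth_on U f" "p \<in> U"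
  shows "((\<lambda>x. f (torus_proj x)) has_derivative dir_deriv f p) (at (torus_rep p))"
proof -
  have "Ck_on (Suc 0) (torus_proj -` U) (\<lambda>x. f (torus_proj x))"
    using assms(1) unfolding smooth_on_def by blast
  from Ck_on_SucD(1)[OF this, of "torus_rep p"] assms(2) show ?thesis
    by (simp add: dir_deriv_def[abs_def])
qed

lemma linear_dir_deriv: "smooth_on U f \<Longrightarrow> p \<in> U \<Longrightarrow> linear (dir_deriv f p)"
  using has_dir_deriv by (rule has_derivative_linear)

lemma dir_deriv_cong:
  assumes "p \<in> U" "\<And>q. q \<in> U \<Longrightarrow> f q = g q"
  shows "dir_deriv f p v = dir_deriv g p v"
  unfolding dir_deriv_def
  by (subst frechet_derivative_cong_open[OF open_lift, of _ _ "\<lambda>x. g (torus_proj x)"])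
    (use assms in auto)

lemma dir_deriv_add:
  assumes "smooth_on U f" "smooth_on U g" "p \<in> U"
  shows "dir_deriv (\<lambda>q. f q + g q) p v = dir_deriv f p v + dir_deriv g p v"
  by (rule dir_deriv_eqI has_derivative_add has_dir_deriv assms)+

lemma dir_deriv_bilinear:
  assumes "bounded_bilinear m" "smooth_on U f" "smooth_on U g" "p \<in> U"
  shows "dir_deriv (\<lambda>q. m (f q) (g q)) p v = m (f p) (dir_deriv g p v) + m (dir_deriv f p v) (g p)"
  using dir_deriv_eqI[OF bounded_bilinear.FDERIV[OF assms(1) has_dir_deriv[OF assms(2,4)]
        has_dir_deriv[OF assms(3,4)]], of v]
  by simp

lemma dir_deriv_compose_real:
  assumes "smooth_on U f" "p \<in> U" "(\<phi> has_real_derivative d) (at (f p))"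
  shows "dir_deriv (\<lambda>q. \<phi> (f q)) p v = d * dir_deriv f p v"
  by (rule dir_deriv_eqI)
    (use has_derivative_compose[OF has_dir_deriv[OF assms(1,2)], of \<phi> "\<lambda>t. d * t"] assms(3)
      in \<open>simp add: has_field_derivative_def\<close>)

lemma smooth_on_cong:
  assumes "smooth_on U f" "\<And>p. p \<in> U \<Longrightarrow> f p = g p"
  shows "smooth_on U g"
  using assms Ck_on_cong[OF open_lift, of "\<lambda>x. f (torus_proj x)" "\<lambda>x. g (torus_proj x)"]
  unfolding smooth_on_def by auto

lemma smooth_on_const: "smooth_on U (\<lambda>p. c)"
  by (simp add: smooth_on_def Ck_on_const[OF open_lift])

lemma smooth_on_add: "smooth_on U f \<Longrightarrow> smooth_on U g \<Longrightarrow> smooth_on U (\<lambda>p. f p + g p)"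
  by (simp add: smooth_on_def Ck_on_add[OF open_lift])

lemma smooth_on_sum:
  "finite I \<Longrightarrow> (\<And>i. i \<in> I \<Longrightarrow> smooth_on U (f i)) \<Longrightarrow> smooth_on U (\<lambda>p. \<Sum>i\<in>I. f i p)"
  by (induction I rule: finite_induct) (auto intro: smooth_on_const smooth_on_add)

lemma smooth_on_bilinear:
  "bounded_bilinear m \<Longrightarrow> smooth_on U f \<Longrightarrow> smooth_on U g \<Longrightarrow> smooth_on U (\<lambda>p. m (f p) (g p))"
  unfolding smooth_on_def by (auto dest: bounded_bilinear.Ck_on[OF _ open_lift])

lemmas smooth_on_scaleR = smooth_on_bilinear[OF bounded_bilinear_scaleR]
lemmas smooth_on_mult = smooth_on_bilinear[OF bounded_bilinear_mult]
lemmas smooth_on_inner = smooth_on_bilinear[OF bounded_bilinear_inner]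

lemma smooth_on_bounded_linear:
  "bounded_linear L \<Longrightarrow> smooth_on U f \<Longrightarrow> smooth_on U (\<lambda>p. L (f p))"
  using Ck_on_bounded_linear[OF open_lift, of L _ "\<lambda>x. f (torus_proj x)"]
  by (auto simp: smooth_on_def)

lemma smooth_on_exp: "smooth_on U f \<Longrightarrow> smooth_on U (\<lambda>p. exp (f p :: real))"
  by (simp add: smooth_on_def Ck_on_exp[OF open_lift])

lemma smooth_on_ln:
  "smooth_on U f \<Longrightarrow> (\<And>p. p \<in> U \<Longrightarrow> (f p :: real) > 0) \<Longrightarrow> smooth_on U (\<lambda>p. ln (f p))"
  unfolding smooth_on_def by (auto intro!: Ck_on_ln[OF open_lift])

lemma smooth_on_vec:
  fixes X :: vfield
  assumes "\<And>i. smooth_on U (\<lambda>p. X p $ i)"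
  shows "smooth_on U X"
proof (rule smooth_on_cong)
  show "smooth_on U (\<lambda>p. \<Sum>i\<in>UNIV. X p $ i *\<^sub>R axis i 1)"
    by (intro smooth_on_sum smooth_on_scaleR smooth_on_const assms) auto
  show "(\<Sum>i\<in>UNIV. X p $ i *\<^sub>R axis i 1) = X p" for p
    using basis_expansion[of "X p"] by (simp add: scalar_mult_eq_scaleR)
qed

lemma smooth_on_dir_deriv_const:
  assumes "smooth_on U f"
  shows "smooth_on U (\<lambda>p. dir_deriv f p v)"
  using assms Ck_on_SucD(2) unfolding smooth_on_def dir_deriv_torus_proj by blast

lemma dir_deriv_expand:
  assumes "smooth_on U f" "p \<in> U"
  shows "dir_deriv f p v = (\<Sum>i\<in>UNIV. v $ i *\<^sub>R dir_deriv f p (axis i 1))"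
proof -
  have "v = (\<Sum>i\<in>UNIV. v $ i *\<^sub>R axis i 1)"
    using basis_expansion[of v] by (simp add: scalar_mult_eq_scaleR)
  then have "dir_deriv f p v = dir_deriv f p (\<Sum>i\<in>UNIV. v $ i *\<^sub>R axis i 1)"
    by simp
  then show ?thesis
    by (simp add: linear_sum[OF linear_dir_deriv[OF assms]] linear_scale[OF linear_dir_deriv[OF assms]])
qed

text \<open>Only derivatives in constant directions are smooth by definition; a variable direction is
  reduced to them by expanding it in the coordinate frame.\<close>

lemma smooth_on_dir_deriv:
  assumes "smooth_on U f" "smooth_on U X"
  shows "smooth_on U (\<lambda>p. dir_deriv f p (X p))"
proof (rule smooth_on_cong)
  show "smooth_on U (\<lambda>p. \<Sum>i\<in>UNIV. X p $ i *\<^sub>R dir_deriv f p (axis i 1))"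
    by (intro smooth_on_sum smooth_on_scaleR smooth_on_dir_deriv_const assms
        smooth_on_bounded_linear[OF bounded_linear_vec_nth]) auto
qed (use dir_deriv_expand[OF assms(1)] in simp)

end

section \<open>The Levi-Civita connection of a conformally flat metric\<close>

definition flat_gradient :: "(torus \<Rightarrow> real) \<Rightarrow> vfield" where
  "flat_gradient u p = (\<chi> i. dir_deriv u p (axis i 1))"

text \<open>The classical transformation law of the Levi-Civita connection, \<open>dY(X)\<close> being the flat
  covariant derivative of \<open>Y\<close> along \<open>X\<close>.\<close>

definition conformal_connection :: "(torus \<Rightarrow> real) \<Rightarrow> vfield \<Rightarrow> vfield \<Rightarrow> vfield" where
  "conformal_connection u X Y p =
     dir_deriv Y p (X p) + dir_deriv u p (X p) *\<^sub>R Y p + dir_deriv u p (Y p) *\<^sub>R X p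
       - (X p \<bullet> Y p) *\<^sub>R flat_gradient u p"

context open_torus_subset
begin

lemma inner_flat_gradient:
  assumes "smooth_on U u" "p \<in> U"
  shows "flat_gradient u p \<bullet> v = dir_deriv u p v" "v \<bullet> flat_gradient u p = dir_deriv u p v"
  using dir_deriv_expand[OF assms, of v]
  by (simp_all add: flat_gradient_def inner_vec_def mult.commute)

lemma smooth_on_flat_gradient: "smooth_on U u \<Longrightarrow> smooth_on U (flat_gradient u)"
  by (rule smooth_on_vec) (simp add: flat_gradient_def smooth_on_dir_deriv_const)

lemma smooth_on_conformal_connection:
  assumes "smooth_on U u" "smooth_on U X" "smooth_on U Y"
  shows "smooth_on U (conformal_connection u X Y)"
proof -
  have "smooth_on U (\<lambda>p. dir_deriv Y p (X p) + dir_deriv u p (X p) *\<^sub>R Y p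
      + dir_deriv u p (Y p) *\<^sub>R X p + (X p \<bullet> Y p) *\<^sub>R ((- 1) *\<^sub>R flat_gradient u p))"
    by (intro smooth_on_add smooth_on_scaleR smooth_on_dir_deriv smooth_on_inner smooth_on_const
        smooth_on_flat_gradient assms)
  then show ?thesis
    by (rule smooth_on_cong) (simp add: conformal_connection_def)
qed

lemma affine_connection_conformal:
  assumes u: "smooth_on U u"
  shows "affine_connection U (conformal_connection u)"
  unfolding affine_connection_def
proof (intro conjI allI impI ballI)
  fix X Y :: vfield
  assume "smooth_on U X" "smooth_on U Y"
  then show "smooth_on U (conformal_connection u X Y)"
    by (rule smooth_on_conformal_connection[OF u])
next
  fix X X' Y Y' :: vfield and p
  assume "\<forall>p\<in>U. X p = X' p \<and> Y p = Y' p" "p \<in> U"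
  then show "conformal_connection u X Y p = conformal_connection u X' Y' p"
    using dir_deriv_cong[of p Y Y'] by (simp add: conformal_connection_def)
next
  fix X X' Y :: vfield and p
  assume "smooth_on U X" "smooth_on U X'" "smooth_on U Y" "p \<in> U"
  then show "conformal_connection u (\<lambda>q. X q + X' q) Y p
      = conformal_connection u X Y p + conformal_connection u X' Y p"
    by (simp add: conformal_connection_def linear_add[OF linear_dir_deriv] u algebra_simps)
next
  fix f :: "torus \<Rightarrow> real" and X Y :: vfield and p
  assume "smooth_on U f" "smooth_on U X" "smooth_on U Y" "p \<in> U"
  then show "conformal_connection u (\<lambda>q. f q *\<^sub>R X q) Y p = f p *\<^sub>R conformal_connection u X Y p"
    by (simp add: conformal_connection_def linear_scale[OF linear_dir_deriv] u algebra_simps)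
next
  fix X Y Y' :: vfield and p
  assume "smooth_on U X" "smooth_on U Y" "smooth_on U Y'" "p \<in> U"
  then show "conformal_connection u X (\<lambda>q. Y q + Y' q) p
      = conformal_connection u X Y p + conformal_connection u X Y' p"
    by (simp add: conformal_connection_def dir_deriv_add linear_add[OF linear_dir_deriv] u
        algebra_simps)
next
  fix f :: "torus \<Rightarrow> real" and X Y :: vfield and p
  assume "smooth_on U f" "smooth_on U X" "smooth_on U Y" "p \<in> U"
  then show "conformal_connection u X (\<lambda>q. f q *\<^sub>R Y q) p
      = dir_deriv f p (X p) *\<^sub>R Y p + f p *\<^sub>R conformal_connection u X Y p"
    by (simp add: conformal_connection_def dir_deriv_bilinear[OF bounded_bilinear_scaleR]
        linear_scale[OF linear_dir_deriv] u algebra_simps)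
qed

text \<open>The correction terms are symmetric in \<open>X\<close> and \<open>Y\<close>, so the torsion is that of the flat
  connection. In the metric condition the terms with \<open>du(Y)\<close> and \<open>du(Z)\<close> cancel against those
  with \<open>grad u\<close>, and the two copies of \<open>du(X) (Y \<bullet> Z)\<close> match the derivative of \<open>e\<^sup>2\<^sup>u\<close>.\<close>

lemma levi_civita_conformal:
  assumes u: "smooth_on U u"
  shows "levi_civita U (\<lambda>p v w. exp (2 * u p) * flat_metric p v w) (conformal_connection u)"
  unfolding levi_civita_def
proof (intro conjI allI impI ballI)
  show "affine_connection U (conformal_connection u)"
    by (rule affine_connection_conformal[OF u])
next
  fix X Y :: vfield and p
  show "conformal_connection u X Y p - conformal_connection u Y X p = lie_bracket X Y p"
    by (simp add: conformal_connection_def lie_bracket_def inner_commute)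
next
  fix X Y Z :: vfield and p
  assume s: "smooth_on U X" "smooth_on U Y" "smooth_on U Z" and p: "p \<in> U"
  have "dir_deriv (\<lambda>q. exp (2 * u q)) p (X p) = exp (2 * u p) * 2 * dir_deriv u p (X p)"
    by (rule dir_deriv_compose_real[OF u p]) (auto intro!: derivative_eq_intros)
  moreover have "smooth_on U (\<lambda>q. exp (2 * u q))" "smooth_on U (\<lambda>q. Y q \<bullet> Z q)"
    by (intro smooth_on_exp smooth_on_mult smooth_on_inner smooth_on_const u s)+
  ultimately show "dir_deriv (\<lambda>q. exp (2 * u q) * flat_metric q (Y q) (Z q)) p (X p)
      = exp (2 * u p) * flat_metric p (conformal_connection u X Y p) (Z p)
        + exp (2 * u p) * flat_metric p (Y p) (conformal_connection u X Z p)"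
    using s p
    by (simp add: flat_metric_def conformal_connection_def dir_deriv_bilinear[OF bounded_bilinear_mult]
        dir_deriv_bilinear[OF bounded_bilinear_inner] inner_diff_left inner_diff_right
        inner_add_left inner_add_right inner_flat_gradient[OF u p] algebra_simps inner_commute)
qed

lemma riemannian_metric_conformal:
  assumes "smooth_on U u"
  shows "riemannian_metric U (\<lambda>p v w. exp (2 * u p) * flat_metric p v w)"
  unfolding riemannian_metric_def flat_metric_def
  by (auto simp: bilinear_def linear_iff inner_add_left inner_add_right algebra_simps inner_commute
      intro!: smooth_on_mult smooth_on_exp smooth_on_const assms)

end

lemma volume_form_conformal:
  "volume_form (\<lambda>p v w. exp (2 * u p) * flat_metric p v w) p v\<^sub>1 v\<^sub>2 v\<^sub>3
     = exp (3 * u p) * dx_dy_dz p v\<^sub>1 v\<^sub>2 v\<^sub>3"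
proof -
  have "det (\<chi> i j. exp (2 * u p) * flat_metric p (axis i 1) (axis j 1) :: real ^ 3 ^ 3)
      = exp (2 * u p) ^ 3"
    by (simp add: det_3 flat_metric_def inner_axis_axis power3_eq_cube)
  \<comment> \<open>A perfect square, so that the square root in the volume form can be taken.\<close>
  also have "\<dots> = (exp (3 * u p))\<^sup>2"
    by (simp flip: exp_of_nat_mult)
  finally show ?thesis
    by (simp add: volume_form_def)
qed

section \<open>Fields with parallel curl\<close>

lemma dx_dy_dz_cart:
  "dx_dy_dz p v w z =
     v $ 1 * (w $ 2 * z $ 3 - w $ 3 * z $ 2) + v $ 2 * (w $ 3 * z $ 1 - w $ 1 * z $ 3)
       + v $ 3 * (w $ 1 * z $ 2 - w $ 2 * z $ 1)"
  by (simp add: dx_dy_dz_def det_3 algebra_simps)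

lemma bounded_linear_dx_dy_dz: "bounded_linear (\<lambda>v. dx_dy_dz p v w z)"
  unfolding dx_dy_dz_cart
  by (intro bounded_linear_intros bounded_linear_compose[OF bounded_linear_mult_left bounded_linear_vec_nth])

context open_torus_subset
begin

text \<open>The exterior derivative of \<open>\<iota>\<^sub>V (dx \<and> dy \<and> dz)\<close> is \<open>(div V) dx \<and> dy \<and> dz\<close>: in three
  dimensions the alternating sum of determinants is the trace of \<open>dV\<close> times the determinant.\<close>

lemma closed_interior_product_dx_dy_dz:
  assumes V: "smooth_on U V"
    and div: "\<And>p. p \<in> U \<Longrightarrow> (\<Sum>i\<in>UNIV. dir_deriv V p (axis i 1) $ i) = 0"
  shows "closed_two_form U (interior_product V dx_dy_dz)"
proof -
  have form: "interior_product V dx_dy_dz q v w = dx_dy_dz p (V q) v w" for p q v w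
    by (simp add: interior_product_def dx_dy_dz_def)
  have deriv: "dir_deriv (\<lambda>q. interior_product V dx_dy_dz q v w) p z
      = dx_dy_dz p (dir_deriv V p z) v w" if "p \<in> U" for p v w z
    unfolding form[of _ _ _ p]
    by (rule dir_deriv_eqI[OF bounded_linear.has_derivative[OF bounded_linear_dx_dy_dz
            has_dir_deriv[OF V that]]])
  have "smooth_two_form U (interior_product V dx_dy_dz)"
    unfolding smooth_two_form_def
  proof (intro conjI ballI allI)
    show "smooth_on U (\<lambda>p. interior_product V dx_dy_dz p v w)" for v w
      unfolding form[of _ _ _ undefined]
      by (rule smooth_on_bounded_linear[OF bounded_linear_dx_dy_dz V])
  qed (auto simp: interior_product_def dx_dy_dz_cart bilinear_def linear_iff algebra_simps)
  moreover have "ext_deriv (interior_product V dx_dy_dz) p v\<^sub>1 v\<^sub>2 v\<^sub>3 = 0" if p: "p \<in> U"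
    for p v\<^sub>1 v\<^sub>2 v\<^sub>3
  proof -
    have "ext_deriv (interior_product V dx_dy_dz) p v\<^sub>1 v\<^sub>2 v\<^sub>3
        = (\<Sum>i\<in>UNIV. dir_deriv V p (axis i 1) $ i) * dx_dy_dz p v\<^sub>1 v\<^sub>2 v\<^sub>3"
      unfolding ext_deriv_def deriv[OF p]
      unfolding dir_deriv_expand[OF V p, of v\<^sub>1] dir_deriv_expand[OF V p, of v\<^sub>2]
        dir_deriv_expand[OF V p, of v\<^sub>3]
      by (simp add: dx_dy_dz_cart sum_3) algebra
    then show ?thesis
      by (simp add: div[OF p])
  qed
  ultimately show ?thesis
    by (simp add: closed_two_form_def)
qed

text \<open>Assumption \<open>curl\<close> expresses \<open>V \<times> curl V = 0\<close>: the skew part of \<open>dV\<close> acts as the cross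
  product with \<open>curl V / 2\<close>, so \<open>dV(V) \<bullet> w - V \<bullet> dV(w) = (curl V \<times> V) \<bullet> w\<close>.\<close>

theorem conformally_geodesic_of_parallel_curl:
  assumes V: "smooth_on U V" and nz: "\<And>p. p \<in> U \<Longrightarrow> V p \<noteq> 0"
    and div: "\<And>p. p \<in> U \<Longrightarrow> (\<Sum>i\<in>UNIV. dir_deriv V p (axis i 1) $ i) = 0"
    and curl: "\<And>p w. p \<in> U \<Longrightarrow> dir_deriv V p (V p) \<bullet> w = V p \<bullet> dir_deriv V p w"
  shows "conformally_geodesic U flat_metric (interior_product V dx_dy_dz)"
proof -
  define u where "u p = ln (V p \<bullet> V p) * (1 / 2)" for p
  \<comment> \<open>The factor \<open>f\<close> compensates the volume form of the conformal metric.\<close>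
  define f where "f p = exp (- 3 * u p)" for p
  define B where "B p = f p *\<^sub>R V p" for p
  define \<rho> where "\<rho> p = - 1 * dir_deriv u p (B p)" for p
  have VV: "smooth_on U (\<lambda>p. V p \<bullet> V p)"
    by (intro smooth_on_inner V)
  have u: "smooth_on U u"
    unfolding u_def[abs_def] by (intro smooth_on_mult smooth_on_ln VV smooth_on_const) (simp add: nz)
  have f: "smooth_on U f"
    unfolding f_def[abs_def] by (intro smooth_on_exp smooth_on_mult smooth_on_const u)
  have B: "smooth_on U B"
    unfolding B_def[abs_def] by (intro smooth_on_scaleR f V)
  have \<rho>: "smooth_on U \<rho>"
    unfolding \<rho>_def[abs_def] by (intro smooth_on_mult smooth_on_const smooth_on_dir_deriv u B)
  have "conformal_connection u B B p = \<rho> p *\<^sub>R B p" if p: "p \<in> U" for p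
  proof -
    have V0: "V p \<bullet> V p \<noteq> 0"
      using nz[OF p] by simp
    have du: "dir_deriv u p w = (V p \<bullet> dir_deriv V p w) / (V p \<bullet> V p)" for w
    proof -
      have "dir_deriv u p w = 1 / (V p \<bullet> V p) * (1 / 2) * dir_deriv (\<lambda>q. V q \<bullet> V q) p w"
        unfolding u_def[abs_def]
        by (rule dir_deriv_compose_real[OF VV p])
          (use nz[OF p] in \<open>auto intro!: derivative_eq_intros\<close>)
      also have "dir_deriv (\<lambda>q. V q \<bullet> V q) p w = 2 * (V p \<bullet> dir_deriv V p w)"
        using dir_deriv_bilinear[OF bounded_bilinear_inner V V p] by (simp add: inner_commute)
      finally show ?thesis
        by simp
    qed
    \<comment> \<open>The only use of the assumption on the curl: the acceleration is exactly the gradient term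
      that the conformal change subtracts.\<close>
    have acceleration: "dir_deriv V p (V p) = (V p \<bullet> V p) *\<^sub>R flat_gradient u p"
    proof (rule vector_eq_rdot[THEN iffD1], rule allI)
      show "dir_deriv V p (V p) \<bullet> w = (V p \<bullet> V p) *\<^sub>R flat_gradient u p \<bullet> w" for w
        using curl[OF p, of w] V0 by (simp add: inner_flat_gradient[OF u p] du)
    qed
    have df: "dir_deriv f p w = - 3 * f p * dir_deriv u p w" for w
      unfolding f_def[abs_def]
      by (rule dir_deriv_compose_real[OF u p]) (auto intro!: derivative_eq_intros)
    have dB: "dir_deriv B p w = f p *\<^sub>R dir_deriv V p w + dir_deriv f p w *\<^sub>R V p" for w
      unfolding B_def[abs_def] by (rule dir_deriv_bilinear[OF bounded_bilinear_scaleR f V p])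
    show ?thesis
      unfolding conformal_connection_def dB df \<rho>_def
      by (simp add: B_def linear_scale[OF linear_dir_deriv[OF V p]]
          linear_scale[OF linear_dir_deriv[OF u p]] acceleration vec_eq_iff algebra_simps)
  qed
  moreover have "associated_field U (\<lambda>p v w. exp (2 * u p) * flat_metric p v w)
      (interior_product V dx_dy_dz) B"
  proof -
    have "exp (3 * u p) * f p = 1" for p
      by (simp add: f_def flip: exp_add)
    then have "interior_product B (volume_form (\<lambda>p v w. exp (2 * u p) * flat_metric p v w)) p v w
        = interior_product V dx_dy_dz p v w" for p v w
      unfolding interior_product_def volume_form_conformal B_def
      by (simp add: linear_scale[OF bounded_linear.linear[OF bounded_linear_dx_dy_dz]]
          flip: mult.assoc)
    then show ?thesis
      using B by (simp add: associated_field_def)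
  qed
  ultimately have "geodesic_form U (\<lambda>p v w. exp (2 * u p) * flat_metric p v w)
      (interior_product V dx_dy_dz)"
    unfolding geodesic_form_def
    using riemannian_metric_conformal[OF u] closed_interior_product_dx_dy_dz[OF V div]
      levi_civita_conformal[OF u] \<rho>
    by blast
  then show ?thesis
    unfolding conformally_geodesic_def using u by blast
qed

end

section \<open>The ABC flows\<close>

lemma ABC_field_lift:
  "ABC_field a b c (torus_proj x) = vector
     [a * sin (x $ 3) + c * cos (x $ 2),
      b * sin (x $ 1) + a * cos (x $ 3),
      c * sin (x $ 2) + b * cos (x $ 1)]"
  by (simp add: ABC_field_def torus_proj_def csin.abs_eq ccos.abs_eq)

lemma (in open_torus_subset) smooth_on_ABC_field: "smooth_on U (ABC_field a b c)"
proof (rule smooth_on_vec)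
  have trig: "Ck_on k (torus_proj -` U) (\<lambda>x. s * sin (x $ i) + t * cos (x $ j))" for k s t i j
    by (intro Ck_on_add bounded_bilinear.Ck_on[OF bounded_bilinear_mult] Ck_on_const Ck_on_sin
        Ck_on_cos Ck_on_vec_nth open_lift)
  show "smooth_on U (\<lambda>p. ABC_field a b c p $ i)" for i
    using exhaust_3[of i] by (auto simp: smooth_on_def ABC_field_lift trig)
qed

lemma dir_deriv_ABC_field:
  "dir_deriv (ABC_field a b c) p v = vector
     [a * ccos (p $ 3) * v $ 3 - c * csin (p $ 2) * v $ 2,
      b * ccos (p $ 1) * v $ 1 - a * csin (p $ 3) * v $ 3,
      c * ccos (p $ 2) * v $ 2 - b * csin (p $ 1) * v $ 1]"
proof -
  define x where "x = torus_rep p"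
  have p: "p = torus_proj x"
    by (simp add: x_def)
  let ?D = "\<lambda>v. vector
     [a * cos (x $ 3) * v $ 3 - c * sin (x $ 2) * v $ 2,
      b * cos (x $ 1) * v $ 1 - a * sin (x $ 3) * v $ 3,
      c * cos (x $ 2) * v $ 2 - b * sin (x $ 1) * v $ 1] :: real ^ 3"
  have nth: "((\<lambda>x. x $ i) has_derivative (\<lambda>v. v $ i)) (at x)" for i and x :: "real ^ 3"
    by (rule bounded_linear_imp_has_derivative[OF bounded_linear_vec_nth])
  have trig: "((\<lambda>x. s * sin (x $ i) + t * cos (x $ j)) has_derivative
      (\<lambda>v. s * cos (x $ i) * v $ i - t * sin (x $ j) * v $ j)) (at x)"
    for s t i j and x :: "real ^ 3"
    using has_derivative_add[OF has_derivative_mult_right[OF has_derivative_sin[OF nth]]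
        has_derivative_mult_right[OF has_derivative_cos[OF nth]]]
    by (simp add: algebra_simps)
  have "((\<lambda>x. ABC_field a b c (torus_proj x)) has_derivative ?D) (at x)"
  proof (rule has_derivative_componentwise_within[THEN iffD2], rule ballI)
    fix e :: "real ^ 3"
    assume "e \<in> Basis"
    then obtain i where "e = axis i 1"
      by (auto simp: Basis_vec_def)
    then show "((\<lambda>x. ABC_field a b c (torus_proj x) \<bullet> e) has_derivative (\<lambda>v. ?D v \<bullet> e)) (at x)"
      using exhaust_3[of i]
      by (auto simp: ABC_field_lift inner_axis trig)
  qed
  from dir_deriv_eqI[OF this[unfolded x_def], folded x_def] show ?thesis
    by (simp add: p torus_proj_def csin.abs_eq ccos.abs_eq)
qed

theorem corollary1p5:
  fixes a b c :: real and V :: vfield and U :: "torus set" and \<beta> :: two_form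
  assumes "V = ABC_field a b c"
    and "U = {p. V p \<noteq> 0}"
    and "\<beta> = interior_product V dx_dy_dz"
  shows "conformally_geodesic U flat_metric \<beta>"
proof -
  interpret whole: open_torus_subset UNIV
    by unfold_locales simp
  \<comment> \<open>Smoothness on the whole torus gives the continuity that makes \<open>U\<close> open.\<close>
  have "Ck_on 0 UNIV (\<lambda>x. V (torus_proj x))"
    using whole.smooth_on_ABC_field[of a b c] unfolding smooth_on_def assms(1) by (metis vimage_UNIV)
  then have "continuous_on UNIV (\<lambda>x. V (torus_proj x))"
    by simp
  then have "open {x. V (torus_proj x) \<noteq> 0}"
    by (intro open_Collect_neq continuous_on_const)
  then interpret open_torus_subset U
    by unfold_locales (simp add: assms(2) vimage_def)
  show ?thesis
    unfolding assms(3)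
  proof (rule conformally_geodesic_of_parallel_curl)
    show "smooth_on U V"
      unfolding assms(1) by (rule smooth_on_ABC_field)
    show "V p \<noteq> 0" if "p \<in> U" for p
      using that by (simp add: assms(2))
    show "(\<Sum>i\<in>UNIV. dir_deriv V p (axis i 1) $ i) = 0" for p
      by (simp add: assms(1) dir_deriv_ABC_field sum_3 axis_def)
    show "dir_deriv V p (V p) \<bullet> w = V p \<bullet> dir_deriv V p w" for p w
      by (simp add: assms(1) dir_deriv_ABC_field ABC_field_def inner_vec_def sum_3 algebra_simps)
  qed
qed

end
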